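(* The generating function of symmetric interval-closed sets of $\mathbf{A}_{n-1}$ can be expressed as $$\sum_{n\ge0} \left|\mathcal{IC}_{\mathrm{sym}}(\mathbf{A}_{n-1})\right|z^{n}=F(1,1,z)-zF(1,0,z)+zF(0,0,z),$$ where $F(x,y):=F(x,y,z)$ is a formal power series in $z$ with coefficients that are polynomials in $x$ and $y$, satisfying the functional equation $$F(x,y)= 1+z\left(x+\frac{1}{x}+\frac{x}{y}+\frac{y}{x}\right)F(x,y) - z \left(\frac{1}{x}+\frac{y}{x}\right)F(0,y) - z\, \frac{x}{y} F(x,0) - z^2\, \left(F(x,0)-F(0,0)\right).$$
   Context: For a finite poset $P$, a subset $I\subseteq P$ is an interval-closed set if for all $a,b\in I$ and $w\in P$ with $a<w<b$ we have $w\in I$; $\mathcal{IC}(P)$ is the set of all interval-closed sets of $P$ (including the empty set). $\mathbf{A}_k$ is the poset of positive roots of type $A_k$ (the triangular poset with $k$ minimal elements): its elements are the intervals $[i,j]$ with $1\le i\le j\le k$, ordered by inclusion. By convention $\mathbf{A}_0$ and $\mathbf{A}_{-1}$ are empty posets, each having exactly one ICS, which is symmetric. $\mathcal{IC}_{\mathrm{sym}}(\mathbf{A}_k)$ is the set of interval-closed sets of $\mathbf{A}_k$ that are invariant under the vertical reflection $[i,j]\mapsto[k+1-j,k+1-i]$. In the functional equation, the variable $z$ is suppressed: $F(0,y)=F(0,y,z)$, $F(x,0)=F(x,0,z)$, $F(0,0)=F(0,0,z)$. *)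

theory Defs
  imports
    "HOL-Computational_Algebra.Formal_Power_Series"
    "HOL-Computational_Algebra.Polynomial"
    "HOL-Computational_Algebra.Polynomial_Factorial"
begin

definition interval_closed_sets :: "'a::order set \<Rightarrow> 'a set set" where
  "interval_closed_sets P =
     {I. I \<subseteq> P \<and> (\<forall>a\<in>I. \<forall>b\<in>I. \<forall>w\<in>P. a < w \<and> w < b \<longrightarrow> w \<in> I)}"

text \<open>An element of the root poset is an actual integer interval, so that the order of the
  poset is set inclusion. The parameter is an integer because the index -1 occurs;
  the poset is empty for all \<^term>\<open>k \<le> 0\<close>.\<close>

definition root_poset_A :: "int \<Rightarrow> int set set" where
  "root_poset_A k = {{i..j} |i j. 1 \<le> i \<and> i \<le> j \<and> j \<le> k}"

definition reflect :: "int \<Rightarrow> int set \<Rightarrow> int set" where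
  "reflect k S = (\<lambda>t. k + 1 - t) ` S"

lemma reflect_interval: "reflect k {i..j} = {k + 1 - j..k + 1 - i}"
  by (simp add: reflect_def)

definition sym_interval_closed_sets :: "int \<Rightarrow> int set set set" where
  "sym_interval_closed_sets k =
     {I \<in> interval_closed_sets (root_poset_A k). reflect k ` I = I}"

text \<open>A polynomial in x and y is an element of \<^typ>\<open>int poly poly\<close>: the outer variable is x,
  the inner one is y. A series F in z with such coefficients is evaluated coefficientwise at
  x = a, y = b, for a and b in an arbitrary commutative ring.\<close>

definition eval_xy :: "int poly poly \<Rightarrow> 'a::comm_ring_1 \<Rightarrow> 'a \<Rightarrow> 'a" where
  "eval_xy p a b = poly (map_poly (\<lambda>q. poly (map_poly of_int q) b) p) a"

definition series_at :: "int poly poly fps \<Rightarrow> 'a::comm_ring_1 \<Rightarrow> 'a \<Rightarrow> 'a fps" where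
  "series_at F a b = Abs_fps (\<lambda>n. eval_xy (fps_nth F n) a b)"

text \<open>The functional equation contains the Laurent monomials 1/x, x/y and y/x, so it is stated
  for power series in z over the field of rational functions in x and y.\<close>

definition var_x :: "int poly poly fract" where
  "var_x = to_fract [:0, 1:]"

definition var_y :: "int poly poly fract" where
  "var_y = to_fract [:[:0, 1:]:]"

definition functional_equation :: "int poly poly fps \<Rightarrow> bool" where
  "functional_equation F \<longleftrightarrow>
     (let x = var_x; y = var_y; z = fps_X; c = fps_const in
      series_at F x y =
        1 + z * c (x + 1 / x + x / y + y / x) * series_at F x y
          - z * c (1 / x + y / x) * series_at F 0 y
          - z * c (x / y) * series_at F x 0
          - z ^ 2 * (series_at F x 0 - series_at F 0 0))"

end

theory Submission
  imports Defs
begin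

text \<open>A symmetric interval-closed set is determined by its part in the left half of the poset,
  the intervals \<open>[i, j]\<close> with \<open>i + j \<le> n\<close>. Folding the right half onto the left half is
  monotone, so these parts are exactly the interval-closed sets of the left half
  (\<open>bij_betw_left_half\<close>). In any finite poset an interval-closed set \<open>I\<close> is a difference
  \<open>U - L\<close> of two down-sets, and the choice becomes unique when \<open>U\<close> is as small as possible,
  that is, when no maximal element of \<open>U\<close> lies in \<open>L\<close> (\<open>bij_betw_reduced_pairs\<close>).

  Draw \<open>[i, j]\<close> in column \<open>i + j\<close> at height \<open>j - i + 2\<close>. The upper boundary of a down-set of
  the left half is then a lattice path of length \<open>n\<close> with steps up and down that starts at
  height 0 and never goes below it (\<open>ideal_in_down_sets\<close>, \<open>down_set_is_ideal\<close>). A pair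
  \<open>L \<subseteq> U\<close> is a lower path \<open>l\<close> and an upper path \<open>u\<close>, and a maximal element of \<open>U\<close> in \<open>L\<close> is
  a common peak of both, of height at least 2; the last point counts as a peak when both
  paths rise into it, since on the reflection axis the full paths are mirrored
  (\<open>bij_betw_good_pairs\<close>).

  Pairs of paths are counted by the series \<open>F\<close>, where \<open>x\<close> marks the final height of \<open>l\<close> and
  \<open>y\<close> half of the final distance between \<open>u\<close> and \<open>l\<close>. The four monomials \<open>x\<close>, \<open>1/x\<close>, \<open>x/y\<close>,
  \<open>y/x\<close> are the four combinations of steps. The terms with \<open>F(0,y)\<close> and \<open>F(x,0)\<close> under the
  factor \<open>z\<close> remove the steps that take \<open>l\<close> below 0 or \<open>u\<close> below \<open>l\<close>, and the term with
  \<open>z\<^sup>2\<close> removes the common peaks: such a peak arises from a pair of equal final heights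
  \<open>a \<ge> 1\<close> by a common rise and a common fall (\<open>card_pairs_at_Suc\<close>). Hence \<open>F(1,1)\<close> counts
  the pairs without common peaks strictly before the end, and \<open>z F(1,0) - z F(0,0)\<close> counts
  those among them that end with a forbidden common rise. As the functional equation is a
  recursion for the coefficients (\<open>functional_equation_coef\<close>), it has exactly one solution,
  which is this series.\<close>

section \<open>The functional equation as a recursion for coefficients\<close>

definition drop_y :: "int poly poly \<Rightarrow> int poly poly" where
  "drop_y p = map_poly (\<lambda>q. [:coeff q 0:]) p"

lemma coeff_drop_y: "coeff (drop_y p) a = [:coeff (coeff p a) 0:]"
  unfolding drop_y_def by (simp add: coeff_map_poly)

lemma to_fract_of_int: "to_fract (of_int c) = of_int c"
proof -
  have "to_fract (of_nat n) = of_nat n" for n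
    by (induction n) (simp_all add: to_fract_add)
  then show ?thesis
    by (cases c rule: int_cases2) simp_all
qed

lemma eval_in_var_y: "poly (map_poly of_int q) var_y = to_fract [:q:]"
proof (induction q)
  case (pCons c q)
  have "(of_int c :: int poly poly fract) = to_fract [:[:c:]:]"
    by (metis to_fract_of_int of_int_poly of_int_eq_id id_apply)
  moreover have "[:pCons c q:] = [:[:c:]:] + [:[:0,1:]:] * [:q:]" by simp
  ultimately show ?case
    by (simp only: to_fract_add to_fract_mult map_poly_pCons)
        (use pCons in \<open>simp add: map_poly_pCons var_y_def\<close>)
qed simp

text \<open>The functional equation lives over the rational functions. Substituting the variables for
  themselves is the embedding of the polynomials, so that after multiplication by \<open>x y\<close> the
  equation is one between polynomials and can be read off coefficient by coefficient.\<close>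

lemma eval_xy_var_var: "eval_xy p var_x var_y = to_fract p"
proof (induction p)
  case (pCons c p)
  have "pCons c p = [:c:] + [:0,1:] * p" by simp
  then show ?case
    using pCons
        by (metis (no_types, lifting) eval_in_var_y eval_xy_def map_poly_pCons map_poly_0
            poly_0 poly_pCons to_fract_add to_fract_mult var_x_def)
qed (simp add: eval_xy_def)

lemma eval_xy_0_var: "eval_xy p 0 var_y = to_fract [:coeff p 0:]"
  by (simp add: eval_xy_def poly_0_coeff_0 coeff_map_poly eval_in_var_y)

lemma eval_xy_0_right: "eval_xy p x 0 = eval_xy (drop_y p) x y"
  unfolding eval_xy_def drop_y_def
  by (subst map_poly_map_poly) (simp_all add: o_def poly_0_coeff_0 coeff_map_poly map_poly_pCons)

lemma eval_xy_var_0: "eval_xy p var_x 0 = to_fract (drop_y p)"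
  by (metis eval_xy_0_right eval_xy_var_var)

lemma eval_xy_0_0: "eval_xy p 0 0 = of_int (coeff (coeff p 0) 0)"
  by (simp add: eval_xy_def poly_0_coeff_0 coeff_map_poly)

lemma eval_xy_0_0_fract: "eval_xy p 0 0 = to_fract [:[:coeff (coeff p 0) 0:]:]"
  using eval_xy_0_var[of "drop_y p"] eval_xy_0_right[of p 0 var_y] by (simp add: coeff_drop_y)

lemma var_nonzero: "var_x \<noteq> 0" "var_y \<noteq> 0"
  by (simp_all add: var_x_def var_y_def)

lemma functional_equation_fract:
  "functional_equation F \<longleftrightarrow> to_fract (fps_nth F 0) = 1 \<and> (\<forall>n. to_fract (fps_nth F (Suc n)) =
     (var_x + 1/var_x + var_x/var_y + var_y/var_x) * to_fract (fps_nth F n)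
      - (1/var_x + var_y/var_x) * to_fract [:coeff (fps_nth F n) 0:]
          - var_x/var_y * to_fract (drop_y (fps_nth F n))
      - (if n = 0 then 0 else to_fract (drop_y (fps_nth F (n-1)))
          - to_fract [:[:coeff (coeff (fps_nth F (n-1)) 0) 0:]:]))"
proof -
  have split: "(\<forall>n. P n) \<longleftrightarrow> P 0 \<and> (\<forall>n. P (Suc n))" for P :: "nat \<Rightarrow> bool"
    by (metis not0_implies_Suc)
  show ?thesis
    unfolding functional_equation_def Let_def fps_eq_iff
    by (subst split)
      (simp add: series_at_def mult.assoc fps_X_power_mult_nth eval_xy_var_var eval_xy_0_var
        eval_xy_var_0 eval_xy_0_0_fract power2_eq_square)
qed

lemma clear_denominators:
  assumes "x \<noteq> 0" "y \<noteq> 0"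
  shows "A = (x + 1/x + x/y + y/x) * B - (1/x + y/x) * C - x/y * D - E \<longleftrightarrow>
      x*y*A = (x*(x*y) + y + x*x + y*y) * B - (y + y*y) * C - x*x * D - x*y*(E :: 'a :: field)"
proof -
  have "x*y*((x + 1/x + x/y + y/x) * B - (1/x + y/x) * C - x/y * D - E) =
       (x*(x*y) + y + x*x + y*y) * B - (y + y*y) * C - x*x * D - x*y*E"
    using assms by (simp add: field_simps)
  then show ?thesis using assms by (metis mult_cancel_left mult_eq_0_iff)
qed

lemma functional_equation_poly:
  "functional_equation F \<longleftrightarrow> fps_nth F 0 = 1 \<and> (\<forall>n. let x = [:0, 1:]; y = [:[:0, 1:]:] in
    x * y * fps_nth F (Suc n) = (x*(x * y) + y + x*x + y*y) * fps_nth F n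
        - (y + y*y) * [:coeff (fps_nth F n) 0:]
       - x*x * drop_y (fps_nth F n)
       - x * y * (if n = 0 then 0
           else drop_y (fps_nth F (n-1)) - [:[:coeff (coeff (fps_nth F (n-1)) 0) 0:]:]))"
proof -
  have if_fract: "(if b then 0 else to_fract p - to_fract q) = to_fract (if b then 0 else p - q)"
      for b and p q :: "int poly poly"
    by simp
  show ?thesis
  unfolding functional_equation_fract clear_denominators[OF var_nonzero] if_fract Let_def
  unfolding var_x_def var_y_def to_fract_mult[symmetric] to_fract_add[symmetric] to_fract_diff[symmetric]
      to_fract_eq_iff
  by (metis to_fract_1 to_fract_eq_iff)
qed

definition coef :: "int poly poly fps \<Rightarrow> nat \<Rightarrow> nat \<Rightarrow> nat \<Rightarrow> int" where
  "coef F n a b = coeff (coeff (fps_nth F n) a) b"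

text \<open>The coefficient of \<open>x\<^sup>a y\<^sup>b\<close> after one step: the predecessors of \<open>(a, b)\<close> under the steps
  \<open>1/x\<close>, \<open>y/x\<close>, \<open>x\<close> and \<open>x/y\<close>, in this order, that lie in the quarter plane.\<close>

definition step_count :: "(nat \<Rightarrow> nat \<Rightarrow> int) \<Rightarrow> nat \<Rightarrow> nat \<Rightarrow> int" where
  "step_count f a b = f (Suc a) b + (if b = 0 then 0 else f (Suc a) (b - 1))
     + (if a = 0 then 0 else f (a - 1) b + f (a - 1) (Suc b))"

text \<open>The subtracted terms of order 1 in \<open>z\<close> cancel exactly the monomials with a negative
  exponent, so the equation is a recursion that expresses each coefficient through those of
  lower order in \<open>z\<close>. This gives both the existence and the uniqueness of the solution.\<close>

lemma functional_equation_coef: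
  "functional_equation F \<longleftrightarrow>
    (\<forall>a b. coef F 0 a b = (if a = 0 \<and> b = 0 then 1 else 0)) \<and>
    (\<forall>n a b. coef F (Suc n) a b = step_count (coef F n) a b
       - (if n = 0 \<or> a = 0 \<or> b \<noteq> 0 then 0 else coef F (n - 1) a 0))"
proof -
  have *: "fps_nth F 0 = 1 \<longleftrightarrow> (\<forall>a b. coef F 0 a b = (if a = 0 \<and> b = 0 then 1 else 0))"
    by (auto simp: poly_eq_iff coef_def coeff_1)
  have **: "(let x = [:0, 1:]; y = [:[:0, 1:]:] in
    x * y * P = (x*(x * y) + y + x*x + y*y) * Q - (y + y*y) * [:coeff Q 0:]
       - x*x * drop_y Q - x * y * R) \<longleftrightarrow>
           (\<forall>a b. coeff (coeff P a) b = step_count (\<lambda>a b. coeff (coeff Q a) b) a b - coeff (coeff R a) b)"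
      for P Q R :: "int poly poly"
  proof -
    let ?d = "\<lambda>a b. step_count (\<lambda>a b. coeff (coeff Q a) b) a b - coeff (coeff R a) b"
    let ?L = "[:0, 1:] * [:[:0, 1:]:] * P"
        and ?R = "([:0, 1:] * ([:0, 1:] * [:[:0, 1:]:]) + [:[:0, 1:]:] + [:0, 1:] * [:0, 1:] + [:[:0, 1:]:] * [:[:0, 1:]:])
            * Q -
      ([:[:0, 1:]:] + [:[:0, 1:]:] * [:[:0, 1:]:]) * [:coeff Q 0:] - [:0, 1:] * [:0, 1:] * drop_y Q
          - [:0, 1:] * [:[:0, 1:]:] * R"
    \<comment> \<open>The factor \<open>x y\<close> shifts both indices by one; on the boundary both sides vanish.\<close>
    have L: "coeff (coeff ?L a) b = (if a = 0 \<or> b = 0 then 0 else coeff (coeff P (a - 1)) (b - 1))" for a b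
      by (cases a; cases b) simp_all
    have R: "coeff (coeff ?R a) b = (if a = 0 \<or> b = 0 then 0 else ?d (a - 1) (b - 1))" for a b
      by (cases a; cases b; cases "a - 1"; cases "b - 1")
        (simp_all add: step_count_def algebra_simps coeff_drop_y)
    have "?L = ?R \<longleftrightarrow> (\<forall>a b. coeff (coeff ?L a) b = coeff (coeff ?R a) b)"
      by (metis poly_eqI)
    also have "\<dots> \<longleftrightarrow> (\<forall>a b. coeff (coeff P a) b = ?d a b)"
      unfolding L R by (metis Zero_not_Suc diff_Suc_1)
    finally show ?thesis by (simp only: Let_def)
  qed
  show ?thesis unfolding * ** functional_equation_poly coef_def
  by (intro arg_cong2[of _ _ _ _ "(\<and>)"] refl arg_cong[where f = All] ext)
      (auto simp: coeff_drop_y coeff_pCons split: nat.splits)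
qed

lemma series_with_coef:
  assumes "\<And>n a b. n < a \<or> n < b \<Longrightarrow> f n a b = 0"
  shows "\<exists>F. coef F = f"
proof -
  define F where "F = Abs_fps (\<lambda>n. \<Sum>a\<le>n. monom (\<Sum>b\<le>n. monom (f n a b) b) a)"
  have "coef F n a b = f n a b" for n a b
  proof -
    have "coef F n a b = (if a \<le> n \<and> b \<le> n then f n a b else 0)"
      by (simp add: F_def coef_def coeff_sum if_distrib[of "\<lambda>p. coeff p _"] cong: if_cong)
    then show ?thesis using assms by (metis not_le)
  qed
  then show ?thesis by blast
qed

lemma poly_altdef_le:
  fixes p :: "'a :: comm_ring_1 poly"
  shows "\<forall>i>n. coeff p i = 0 \<Longrightarrow> poly p x = (\<Sum>i\<le>n. coeff p i * x ^ i)"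
proof -
  assume "\<forall>i>n. coeff p i = 0"
  then have "degree p \<le> n" by (simp add: degree_le)
  then show ?thesis
    unfolding poly_altdef by (intro sum.mono_neutral_left) (auto simp: coeff_eq_0)
qed

lemma eval_xy_1_int: "eval_xy p (1::int) y = (\<Sum>a\<le>n. poly (coeff p a) y)" if "\<And>a. n < a \<Longrightarrow> coeff p a = 0"
proof -
  have [simp]: "map_poly of_int q = q" for q :: "int poly"
    by (simp add: map_poly_idI)
  show ?thesis
    using that by (simp add: eval_xy_def poly_altdef_le[of n "map_poly _ p"] coeff_map_poly)
qed

lemma series_at_corner:
  assumes "\<And>n a b. n < a \<or> n < b \<Longrightarrow> coef F n a b = 0"
  shows "fps_nth (series_at F 1 1) n = (\<Sum>a\<le>n. \<Sum>b\<le>n. coef F n a b)" (is ?A)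
    and "fps_nth (series_at F 1 0) n = (\<Sum>a\<le>n. coef F n a 0)" (is ?B)
    and "fps_nth (series_at F 0 0) n = coef F n 0 0" (is ?C)
proof -
  have 1: "coeff (fps_nth F n) a = 0" if "n < a" for a
    using assms[of n a] that by (simp add: coef_def poly_eq_iff)
  have 2: "poly (coeff (fps_nth F n) a) 1 = (\<Sum>b\<le>n. coef F n a b)" for a
    using assms by (subst poly_altdef_le[of n]) (auto simp: coef_def)
  show ?A ?B ?C
    using 1 2 by (simp_all add: series_at_def eval_xy_1_int[of n] poly_0_coeff_0 eval_xy_0_0 coef_def)
qed

section \<open>Interval-closed sets as differences of down-sets; folding the root poset\<close>

definition down_sets :: "'a::order set \<Rightarrow> 'a set set" where
  "down_sets P = {U. U \<subseteq> P \<and> (\<forall>x\<in>U. \<forall>y\<in>P. y < x \<longrightarrow> y \<in> U)}"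

text \<open>In a finite poset, the last condition singles out, among all pairs of down-sets with the
  same difference, the pair with the smallest \<open>U\<close>.\<close>

definition reduced_pairs :: "'a::order set \<Rightarrow> ('a set \<times> 'a set) set" where
  "reduced_pairs P = {(U, L). U \<in> down_sets P \<and> L \<in> down_sets P \<and> L \<subseteq> U \<and> (\<forall>x\<in>L. \<exists>y\<in>U. x < y)}"

text \<open>In a finite poset every element of \<open>U\<close> lies below a maximal one of \<open>U\<close>, and the maximal
  elements of \<open>U\<close> avoid \<open>L\<close>; so \<open>U\<close> is recovered from \<open>U - L\<close> as its down-closure.\<close>

lemma below_difference:
  assumes "finite P" "(U, L) \<in> reduced_pairs P" "x \<in> U"
  shows "\<exists>y\<in>U - L. x \<le> y"
proof -
  have "finite U" using assms by (auto simp: reduced_pairs_def down_sets_def intro: finite_subset)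
  then obtain y where "y \<in> U" "x \<le> y" "\<forall>z\<in>U. y \<le> z \<longrightarrow> y = z"
    using finite_has_maximal2[OF \<open>finite U\<close> \<open>x \<in> U\<close>] by blast
  moreover from this have "y \<notin> L" using assms(2) by (auto simp: reduced_pairs_def less_le)
  ultimately show ?thesis by blast
qed

text \<open>The inverse map sends \<open>I\<close> to its down-closure and the part of the down-closure outside
  \<open>I\<close>. That part is a down-set because \<open>I\<close> is interval-closed: an element outside \<open>I\<close> but
  below an element of \<open>I\<close> has no element of \<open>I\<close> below it.\<close>

lemma bij_betw_reduced_pairs:
  assumes "finite (P :: 'a::order set)"
  shows "bij_betw (\<lambda>(U, L). U - L) (reduced_pairs P) (interval_closed_sets P)"
proof -
  define down where "down I = {x \<in> P. \<exists>y\<in>I. x \<le> y}" for I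
  have 1: "down (U - L) = U" if "(U, L) \<in> reduced_pairs P" for U L
  proof
    show "down (U - L) \<subseteq> U"
      using that by (auto simp: down_def reduced_pairs_def down_sets_def le_less)
    show "U \<subseteq> down (U - L)"
      using below_difference[OF assms that] that by (auto simp: down_def reduced_pairs_def down_sets_def)
  qed
  have 2: "(down I, down I - I) \<in> reduced_pairs P" "down I - (down I - I) = I"
    if I: "I \<in> interval_closed_sets P" for I
  proof -
    have IP: "I \<subseteq> down I" using I by (auto simp: down_def interval_closed_sets_def)
    then show "down I - (down I - I) = I" by blast
    have "down I \<in> down_sets P" by (auto simp: down_def down_sets_def intro: order_trans less_imp_le)
    moreover have "down I - I \<in> down_sets P"
    proof -
      have "y \<notin> I" if x: "x \<in> down I" "x \<notin> I" "y < x" for x y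
      proof
        assume "y \<in> I"
        obtain z where "z \<in> I" "x \<le> z" "x \<in> P" using x by (auto simp: down_def)
        moreover from this have "x < z" using x by (auto simp: le_less)
        ultimately have "x \<in> I"
          using I \<open>y \<in> I\<close> x unfolding interval_closed_sets_def by blast
        then show False using x by blast
      qed
      then show ?thesis using \<open>down I \<in> down_sets P\<close> by (auto simp: down_sets_def)
    qed
    moreover have "\<exists>y\<in>down I. x < y" if x: "x \<in> down I - I" for x
    proof -
      obtain z where "z \<in> I" "x \<le> z" using x by (auto simp: down_def)
      then show ?thesis using x IP by (metis DiffD2 in_mono le_less)
    qed
    ultimately show "(down I, down I - I) \<in> reduced_pairs P"
      by (auto simp: reduced_pairs_def)
  qed
  show ?thesis
  proof (rule bij_betw_byWitness[where f' = "\<lambda>I. (down I, down I - I)"])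
    show "(\<lambda>(U, L). U - L) ` reduced_pairs P \<subseteq> interval_closed_sets P"
      by (auto simp: reduced_pairs_def down_sets_def interval_closed_sets_def)
    show "\<forall>q\<in>reduced_pairs P. (\<lambda>I. (down I, down I - I)) ((\<lambda>(U, L). U - L) q) = q"
    proof
      fix q assume "q \<in> reduced_pairs P"
      moreover obtain U L where "q = (U, L)" by fastforce
      moreover have "U - (U - L) = L" if "L \<subseteq> U" using that by blast
      ultimately show "(\<lambda>I. (down I, down I - I)) ((\<lambda>(U, L). U - L) q) = q"
        using 1[of U L] by (simp add: reduced_pairs_def)
    qed
  qed (use 2 in auto)
qed

text \<open>The reflection maps \<open>i + j\<close> to \<open>2 n - (i + j)\<close>, so the left half includes the axis.\<close>

definition half_poset :: "nat \<Rightarrow> int set set" where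
  "half_poset n = {{int i..int j} |i j. 1 \<le> i \<and> i \<le> j \<and> i + j \<le> n}"

lemma root_poset_nat: "root_poset_A (int n - 1) = {{int i..int j} |i j. 1 \<le> i \<and> i \<le> j \<and> j < n}"
proof (intro set_eqI iffI)
  fix S assume "S \<in> root_poset_A (int n - 1)"
  then obtain i j where "S = {i..j}" "1 \<le> i" "i \<le> j" "j \<le> int n - 1" by (auto simp: root_poset_A_def)
  then have "S = {int (nat i)..int (nat j)}" "1 \<le> nat i" "nat i \<le> nat j" "nat j < n" by auto
  then show "S \<in> {{int i..int j} |i j. 1 \<le> i \<and> i \<le> j \<and> j < n}" by blast
next
  fix S assume "S \<in> {{int i..int j} |i j. 1 \<le> i \<and> i \<le> j \<and> j < n}"
  then obtain i j where "S = {int i..int j}" "1 \<le> i" "i \<le> j" "j < n" by auto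
  then have "S = {int i..int j}" "1 \<le> int i" "int i \<le> int j" "int j \<le> int n - 1" by auto
  then show "S \<in> root_poset_A (int n - 1)" unfolding root_poset_A_def by blast
qed

lemma interval_in_half_poset:
  "i \<le> j \<Longrightarrow> {int i..int j} \<in> half_poset n \<longleftrightarrow> 1 \<le> i \<and> i + j \<le> n"
  by (auto simp: half_poset_def Icc_eq_Icc)

lemma half_poset_subset: "half_poset n \<subseteq> root_poset_A (int n - 1)"
  unfolding root_poset_nat half_poset_def by fastforce

lemma reflect_interval_nat:
  "i \<le> n \<Longrightarrow> j \<le> n \<Longrightarrow> reflect (int n - 1) {int i..int j} = {int (n - j)..int (n - i)}"
  by (simp add: reflect_interval)

lemma reflect_reflect: "reflect k (reflect k S) = S"
  by (simp add: reflect_def image_image)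

lemma reflect_root_poset:
  "S \<in> root_poset_A (int n - 1) \<Longrightarrow> reflect (int n - 1) S \<in> root_poset_A (int n - 1)"
proof -
  assume "S \<in> root_poset_A (int n - 1)"
  then obtain i j where ij: "S = {int i..int j}" "1 \<le> i" "i \<le> j" "j < n" by (auto simp: root_poset_nat)
  then have "1 \<le> n - j" "n - j \<le> n - i" "n - i < n" by auto
  moreover have "reflect (int n - 1) S = {int (n - j)..int (n - i)}"
    using ij by (simp only: reflect_interval_nat[of i n j])
  ultimately show ?thesis unfolding root_poset_nat by blast
qed

definition fold_left :: "nat \<Rightarrow> int set \<Rightarrow> int set" where
  "fold_left n S = (if S \<in> half_poset n then S else reflect (int n - 1) S)"

lemma fold_left_interval:
  assumes "1 \<le> i" "i \<le> j" "j < n"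
  shows "fold_left n {int i..int j} = (if i + j \<le> n then {int i..int j} else {int (n - j)..int (n - i)})"
  using assms by (simp add: fold_left_def interval_in_half_poset reflect_interval_nat)

lemma fold_left_in: "S \<in> root_poset_A (int n - 1) \<Longrightarrow> fold_left n S \<in> half_poset n"
  unfolding root_poset_nat by (auto simp: fold_left_interval interval_in_half_poset simp del: of_nat_diff)

text \<open>If only one of two nested intervals is reflected, the endpoints still nest, because the
  interval that is not reflected has its midpoint on the left of the axis or on it, and the
  other one on the right.\<close>

lemma fold_left_mono:
  assumes "S \<in> root_poset_A (int n - 1)" "T \<in> root_poset_A (int n - 1)" "S \<subseteq> T"
  shows "fold_left n S \<subseteq> fold_left n T"
  using assms unfolding root_poset_nat
  by (auto simp: fold_left_interval split: if_splits)

lemma fold_left_reflect: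
  assumes "S \<in> root_poset_A (int n - 1)"
  shows "fold_left n (reflect (int n - 1) S) = fold_left n S"
proof -
  obtain i j where ij: "S = {int i..int j}" "1 \<le> i" "i \<le> j" "j < n" using assms by (auto simp: root_poset_nat)
  then show ?thesis
    by (auto simp: reflect_interval_nat fold_left_interval simp del: of_nat_diff)
qed

text \<open>Symmetry means that membership of \<open>S\<close> depends only on its fold, which gives the inverse
  map. It produces interval-closed sets since folding is monotone: a chain in the whole
  poset folds to a chain in the left half, in which a strict step may at worst become an
  equality.\<close>

lemma bij_betw_left_half:
  "bij_betw (\<lambda>I. I \<inter> half_poset n) (sym_interval_closed_sets (int n - 1)) (interval_closed_sets (half_poset n))"
proof -
  let ?A = "root_poset_A (int n - 1)" and ?r = "reflect (int n - 1)"
  have fold_mem: "fold_left n S \<in> I \<longleftrightarrow> S \<in> I" if "I \<in> sym_interval_closed_sets (int n - 1)" for S I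
  proof -
    have "?r ` I = I" using that by (simp add: sym_interval_closed_sets_def)
    then have "?r S \<in> I \<longleftrightarrow> S \<in> I" by (metis imageI reflect_reflect)
    then show ?thesis by (simp add: fold_left_def)
  qed
  show ?thesis
  proof (rule bij_betw_byWitness[where f' = "\<lambda>J. {S \<in> ?A. fold_left n S \<in> J}"])
    show "\<forall>I\<in>sym_interval_closed_sets (int n - 1). {S \<in> ?A. fold_left n S \<in> I \<inter> half_poset n} = I"
    proof
      fix I assume I: "I \<in> sym_interval_closed_sets (int n - 1)"
      then have "I \<subseteq> ?A" by (auto simp: sym_interval_closed_sets_def interval_closed_sets_def)
      then show "{S \<in> ?A. fold_left n S \<in> I \<inter> half_poset n} = I"
        using fold_left_in fold_mem[OF I] by auto
    qed
    show "\<forall>J\<in>interval_closed_sets (half_poset n). {S \<in> ?A. fold_left n S \<in> J} \<inter> half_poset n = J"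
    proof
      fix J assume "J \<in> interval_closed_sets (half_poset n)"
      then have "J \<subseteq> half_poset n" by (simp add: interval_closed_sets_def)
      moreover have "fold_left n S = S" if "S \<in> half_poset n" for S
        using that by (simp add: fold_left_def)
      ultimately show "{S \<in> ?A. fold_left n S \<in> J} \<inter> half_poset n = J"
        using half_poset_subset[of n] by (auto dest: subsetD)
    qed
    show "(\<lambda>I. I \<inter> half_poset n) ` sym_interval_closed_sets (int n - 1) \<subseteq> interval_closed_sets (half_poset n)"
    proof (rule image_subsetI)
      fix I assume "I \<in> sym_interval_closed_sets (int n - 1)"
      then have closed: "\<forall>a\<in>I. \<forall>b\<in>I. \<forall>w\<in>?A. a < w \<and> w < b \<longrightarrow> w \<in> I"
        unfolding sym_interval_closed_sets_def interval_closed_sets_def by blast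
      have "w \<in> I" if "a \<in> I" "b \<in> I" "w \<in> half_poset n" "a < w \<and> w < b" for a b w
        using closed that half_poset_subset[of n] by (meson subsetD)
      then show "I \<inter> half_poset n \<in> interval_closed_sets (half_poset n)"
        unfolding interval_closed_sets_def by blast
    qed
    show "(\<lambda>J. {S \<in> ?A. fold_left n S \<in> J}) ` interval_closed_sets (half_poset n)
        \<subseteq> sym_interval_closed_sets (int n - 1)"
    proof (rule image_subsetI)
      fix J assume J: "J \<in> interval_closed_sets (half_poset n)"
      then have closed: "w \<in> J" if "a \<in> J" "b \<in> J" "w \<in> half_poset n" "a < w" "w < b" for a b w
        using that unfolding interval_closed_sets_def by blast
      let ?I = "{S \<in> ?A. fold_left n S \<in> J}"
      have "?r S \<in> ?I" if "S \<in> ?I" for S using that by (simp add: fold_left_reflect reflect_root_poset)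
      then have "?r ` ?I = ?I" using reflect_reflect
          by (metis (no_types, lifting) image_eqI image_subsetI subsetI subset_antisym)
      moreover
      have "w \<in> ?I" if "a \<in> ?I" "b \<in> ?I" "w \<in> ?A" "a < w" "w < b" for a b w
      proof -
        have "fold_left n a \<subseteq> fold_left n w" "fold_left n w \<subseteq> fold_left n b"
          using that by (simp_all add: fold_left_mono psubset_eq)
        moreover have "fold_left n w \<in> half_poset n" using that by (simp add: fold_left_in)
        ultimately have "fold_left n w \<in> J"
          using closed[of "fold_left n a" "fold_left n b" "fold_left n w"] that
          by (cases "fold_left n a = fold_left n w"; cases "fold_left n w = fold_left n b")
              (simp_all add: psubsetI)
        then show ?thesis using that by simp
      qed
      then have "?I \<in> interval_closed_sets ?A"
        unfolding interval_closed_sets_def by blast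
      ultimately show "?I \<in> sym_interval_closed_sets (int n - 1)"
        unfolding sym_interval_closed_sets_def by (intro CollectI conjI)
    qed
  qed
qed

section \<open>Counting pairs of nested lattice paths\<close>

text \<open>Paths of length \<open>n\<close> are functions that vanish beyond \<open>n\<close>, so that a path is determined by
  its first \<open>n\<close> steps and dropping the last step means resetting one value to 0.\<close>

definition ballot :: "nat \<Rightarrow> (nat \<Rightarrow> nat) \<Rightarrow> bool" where
  "ballot n p \<longleftrightarrow> p 0 = 0 \<and> (\<forall>s<n. p (Suc s) = Suc (p s) \<or> p s = Suc (p (Suc s))) \<and> (\<forall>s>n. p s = 0)"

text \<open>For nested paths the lower path also has height \<open>u s\<close> at \<open>s\<close>. The rise ends at height at
  least 2: a rise from 0 to 1 adds no element of the poset.\<close>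

definition common_rise :: "(nat \<Rightarrow> nat) \<times> (nat \<Rightarrow> nat) \<Rightarrow> nat \<Rightarrow> bool" where
  "common_rise = (\<lambda>(u, l) s. l (Suc s) = u (Suc s) \<and> u s < u (Suc s) \<and> 1 \<le> u s)"

definition common_peak :: "(nat \<Rightarrow> nat) \<times> (nat \<Rightarrow> nat) \<Rightarrow> nat \<Rightarrow> bool" where
  "common_peak q s \<longleftrightarrow> common_rise q s \<and> fst q (Suc (Suc s)) < fst q (Suc s)"

definition path_pairs :: "nat \<Rightarrow> ((nat \<Rightarrow> nat) \<times> (nat \<Rightarrow> nat)) set" where
  "path_pairs n = {(u, l). ballot n u \<and> ballot n l \<and> l \<le> u \<and> (\<forall>s. Suc s < n \<longrightarrow> \<not> common_peak (u, l) s)}"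

text \<open>The pairs that contribute to the monomial \<open>x\<^sup>a y\<^sup>b\<close> of the \<open>n\<close>-th coefficient.\<close>

definition pairs_at :: "nat \<Rightarrow> nat \<Rightarrow> nat \<Rightarrow> ((nat \<Rightarrow> nat) \<times> (nat \<Rightarrow> nat)) set" where
  "pairs_at n a b = {(u, l) \<in> path_pairs n. l n = a \<and> u n = a + 2 * b}"

lemma ballot_le: "ballot n p \<Longrightarrow> p s \<le> s"
proof (induction s)
  case (Suc s)
  moreover from Suc.prems have "p (Suc s) = Suc (p s) \<or> p s = Suc (p (Suc s)) \<or> p (Suc s) = 0"
    by (cases "s < n") (auto simp: ballot_def)
  ultimately show ?case by auto
qed (simp add: ballot_def)

lemma ballot_parity: "ballot n p \<Longrightarrow> s \<le> n \<Longrightarrow> even (p s + s)"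
proof (induction s)
  case (Suc s)
  then have "p (Suc s) = Suc (p s) \<or> p s = Suc (p (Suc s))" by (simp add: ballot_def)
  with Suc show ?case by auto
qed (simp add: ballot_def)

lemma ballot_Suc: "ballot (Suc n) p \<longleftrightarrow> ballot n (p(Suc n := 0)) \<and>
    (p (Suc n) = Suc (p n) \<or> p n = Suc (p (Suc n)))" if "\<forall>s>Suc n. p s = 0"
  using that unfolding ballot_def by (auto simp: less_Suc_eq)

lemma finite_path_pairs: "finite (path_pairs n)"
proof -
  have "finite {p. ballot n p}"
  proof (rule finite_subset)
    show "{p. ballot n p} \<subseteq> {p. \<forall>s. (s \<in> {..n} \<longrightarrow> p s \<in> {..n}) \<and> (s \<notin> {..n} \<longrightarrow> p s = 0)}"
    proof (clarify, intro conjI impI)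
      fix p s assume p: "ballot n p"
      show "p s \<in> {..n}" if "s \<in> {..n}" using ballot_le[OF p, of s] that by simp
      show "p s = 0" if "s \<notin> {..n}" using p that by (simp add: ballot_def)
    qed
  qed (intro finite_set_of_finite_funs finite_atMost)
  then have "finite ({p. ballot n p} \<times> {p. ballot n p})" by simp
  then show ?thesis by (rule rev_finite_subset) (auto simp: path_pairs_def)
qed

lemma finite_pairs_at: "finite (pairs_at n a b)"
  by (rule finite_subset[OF _ finite_path_pairs[of n]]) (auto simp: pairs_at_def)

definition truncate :: "nat \<Rightarrow> (nat \<Rightarrow> nat) \<times> (nat \<Rightarrow> nat) \<Rightarrow> (nat \<Rightarrow> nat) \<times> (nat \<Rightarrow> nat)" where
  "truncate n = (\<lambda>(u, l). (u(Suc n := 0), l(Suc n := 0)))"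

lemma bij_betw_extensions:
  assumes "X \<subseteq> path_pairs n"
  shows "bij_betw (\<lambda>(u, l). (u(Suc n := c), l(Suc n := a))) X
     {q. truncate n q \<in> X \<and> snd q (Suc n) = a \<and> fst q (Suc n) = c}"
proof -
  have 0: "u(Suc n := 0) = u \<and> l(Suc n := 0) = l" if "(u, l) \<in> X" for u l
    using that assms by (auto simp: path_pairs_def ballot_def fun_upd_idem)
  show ?thesis
    by (rule bij_betw_byWitness[where f' = "truncate n"])
       (use 0 in \<open>fastforce simp: truncate_def\<close>)+
qed

lemma card_extensions:
  "X \<subseteq> path_pairs n \<Longrightarrow> card {q. truncate n q \<in> X \<and> snd q (Suc n) = a \<and> fst q (Suc n) = c} = card X"
  by (rule bij_betw_same_card[OF bij_betw_extensions, symmetric])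

definition preds :: "nat \<Rightarrow> nat \<Rightarrow> (nat \<times> nat) set" where
  "preds a b = {(a', b'). a' = Suc a \<and> (b' = b \<or> b = Suc b') \<or> a = Suc a' \<and> (b' = b \<or> b' = Suc b)}"

lemma path_pairs_Suc:
  "(u, l) \<in> path_pairs (Suc n) \<longleftrightarrow> truncate n (u, l) \<in> path_pairs n \<and>
     l (Suc n) \<le> u (Suc n) \<and> (u (Suc n) = Suc (u n) \<or> u n = Suc (u (Suc n))) \<and>
     (l (Suc n) = Suc (l n) \<or> l n = Suc (l (Suc n))) \<and> (\<forall>m. n = Suc m \<longrightarrow> \<not> common_peak (u, l) m)"
proof -
  let ?u = "u(Suc n := 0)" and ?l = "l(Suc n := 0)"
  have peak: "common_peak (?u, ?l) s \<longleftrightarrow> common_peak (u, l) s" if "Suc s < n" for s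
    using that by (simp add: common_peak_def common_rise_def)
  have tail: "\<forall>s>Suc n. p s = 0" if "ballot n (p(Suc n := 0)) \<or> ballot (Suc n) p" for p
    using that by (metis Suc_lessD ballot_def fun_upd_other less_irrefl)
  have ballot: "ballot (Suc n) p \<longleftrightarrow> ballot n (p(Suc n := 0)) \<and>
    (p (Suc n) = Suc (p n) \<or> p n = Suc (p (Suc n)))" for p
    using tail[of p] ballot_Suc[of n p] by blast
  have le: "l \<le> u \<longleftrightarrow> ?l \<le> ?u \<and> l (Suc n) \<le> u (Suc n)"
  proof
    assume *: "?l \<le> ?u \<and> l (Suc n) \<le> u (Suc n)"
    show "l \<le> u"
    proof (rule le_funI)
      fix s show "l s \<le> u s"
        using * le_funD[of ?l ?u s] by (cases "s = Suc n") simp_all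
    qed
  qed (simp add: le_fun_def)
  have all_less: "(\<forall>s. Suc s < Suc n \<longrightarrow> P s) \<longleftrightarrow> (\<forall>s. Suc s < n \<longrightarrow> P s) \<and> (\<forall>m. n = Suc m \<longrightarrow> P m)" for P
    by (auto simp: less_Suc_eq)
  show ?thesis
    unfolding path_pairs_def truncate_def mem_Collect_eq prod.case ballot le all_less
    by (auto simp: peak)
qed

lemma even_gap:
  assumes "ballot n u" "ballot n l" "l \<le> u"
  shows "\<exists>b. u n = l n + 2 * b"
proof -
  have "even (u n + n)" "even (l n + n)" "l n \<le> u n"
    using assms ballot_parity by (auto simp: le_fun_def)
  then have "even (u n - l n)" by auto
  with \<open>l n \<le> u n\<close> show ?thesis by (metis evenE le_add_diff_inverse)
qed

text \<open>Dropping the last step leads to a predecessor state; conversely each one-step extension of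
  a pair at a predecessor state is again a pair of paths, unless it completes a common peak.\<close>

lemma pairs_at_Suc:
  "pairs_at (Suc n) a b =
     {q. truncate n q \<in> (\<Union>(a', b')\<in>preds a b. pairs_at n a' b') \<and> snd q (Suc n) = a \<and> fst q (Suc n) = a + 2 * b}
     - {q. \<exists>m. n = Suc m \<and> common_peak q m}"
  (is "?L = ?E - ?B")
proof -
  have "(u, l) \<in> ?L \<longleftrightarrow> (u, l) \<in> ?E - ?B" for u l
  proof (cases "truncate n (u, l) \<in> path_pairs n \<and> l (Suc n) = a \<and> u (Suc n) = a + 2 * b")
    case True
    then obtain b' where b': "u n = l n + 2 * b'"
      using even_gap[of n "u(Suc n := 0)" "l(Suc n := 0)"] by (auto simp: truncate_def path_pairs_def)
    have "truncate n (u, l) \<in> (\<Union>(a', b')\<in>preds a b. pairs_at n a' b') \<longleftrightarrow> (l n, b') \<in> preds a b"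
      using True b' by (auto simp: pairs_at_def truncate_def)
    also have "\<dots> \<longleftrightarrow> (u (Suc n) = Suc (u n) \<or> u n = Suc (u (Suc n))) \<and>
       (l (Suc n) = Suc (l n) \<or> l n = Suc (l (Suc n)))"
      using True b' by (auto simp: preds_def; presburger)
    finally show ?thesis
      using True by (auto simp: pairs_at_def path_pairs_Suc)
  next
    case False
    then show ?thesis by (auto simp: pairs_at_def path_pairs_Suc)
  qed
  then show ?thesis by (metis (no_types, lifting) set_eqI surj_pair)
qed

text \<open>A final common rise from height \<open>a\<close> can be appended to every pair that ends in a common
  point at height \<open>a\<close>: a rise never completes a peak.\<close>

lemma card_rises:
  assumes "1 \<le> a"
  shows "card {(u, l) \<in> path_pairs (Suc n). common_rise (u, l) n \<and> u n = a} = card (pairs_at n a 0)"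
proof -
  have "{(u, l) \<in> path_pairs (Suc n). common_rise (u, l) n \<and> u n = a} =
     {q. truncate n q \<in> pairs_at n a 0 \<and> snd q (Suc n) = Suc a \<and> fst q (Suc n) = Suc a}"
  proof -
    have "(u, l) \<in> path_pairs (Suc n) \<and> common_rise (u, l) n \<and> u n = a \<longleftrightarrow>
      truncate n (u, l) \<in> pairs_at n a 0 \<and> l (Suc n) = Suc a \<and> u (Suc n) = Suc a" for u l
    proof -
      have le: "l n \<le> u n" if "truncate n (u, l) \<in> path_pairs n"
      proof -
        have "l(Suc n := 0) \<le> u(Suc n := 0)" using that by (simp add: path_pairs_def truncate_def)
        then show ?thesis using le_funD[of "l(Suc n := 0)" "u(Suc n := 0)" n] by simp
      qed
      have at: "truncate n (u, l) \<in> pairs_at n a 0 \<longleftrightarrow> truncate n (u, l) \<in> path_pairs n \<and> l n = a \<and> u n = a"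
        by (simp add: pairs_at_def truncate_def)
      show ?thesis
      proof
        assume L: "(u, l) \<in> path_pairs (Suc n) \<and> common_rise (u, l) n \<and> u n = a"
        then have T: "truncate n (u, l) \<in> path_pairs n"
          and steps: "u (Suc n) = Suc (u n) \<or> u n = Suc (u (Suc n))" "l (Suc n) = Suc (l n) \<or> l n = Suc (l (Suc n))"
          unfolding path_pairs_Suc by blast+
        have "l (Suc n) = u (Suc n)" "u n < u (Suc n)" "u n = a" using L by (simp_all add: common_rise_def)
        then have "u (Suc n) = Suc a" "l (Suc n) = Suc a" "l n = a" using steps le[OF T] by linarith+
        then show "truncate n (u, l) \<in> pairs_at n a 0 \<and> l (Suc n) = Suc a \<and> u (Suc n) = Suc a"
          using at T L by simp
      next
        assume R: "truncate n (u, l) \<in> pairs_at n a 0 \<and> l (Suc n) = Suc a \<and> u (Suc n) = Suc a"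
        then have "u n = a" "l n = a" "truncate n (u, l) \<in> path_pairs n" by (simp_all add: at)
        moreover have "\<forall>m. n = Suc m \<longrightarrow> \<not> common_peak (u, l) m"
        proof (intro allI impI)
          fix m assume "n = Suc m"
          then show "\<not> common_peak (u, l) m" using R \<open>u n = a\<close> by (simp add: common_peak_def)
        qed
        ultimately have "(u, l) \<in> path_pairs (Suc n)" using R by (simp only: path_pairs_Suc) simp
        then show "(u, l) \<in> path_pairs (Suc n) \<and> common_rise (u, l) n \<and> u n = a"
          using assms R \<open>u n = a\<close> by (simp add: common_rise_def)
      qed
    qed
    then show ?thesis by auto
  qed
  then show ?thesis
    using card_extensions[of "pairs_at n a 0" n "Suc a" "Suc a"] by (auto simp: pairs_at_def)
qed

text \<open>The arithmetic of a common peak: the heights \<open>y\<close>, \<open>x\<close>, \<open>z\<close> of the upper path and \<open>lx\<close>,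
  \<open>lz\<close> of the lower path are compatible with a peak exactly when both paths go from \<open>a\<close> to
  \<open>a + 1\<close> and back to \<open>a\<close>.\<close>

lemma peak_arith:
  fixes x y z :: nat
  assumes "x = Suc y \<or> y = Suc x"
  shows "(\<exists>(a', b')\<in>preds a b. lx = a' \<and> x = a' + 2 * b') \<and> lz = a \<and> z = a + 2 * b \<and>
       lx = x \<and> y < x \<and> 1 \<le> y \<and> z < x \<longleftrightarrow>
     b = 0 \<and> 1 \<le> a \<and> (lx = x \<and> y < x \<and> 1 \<le> y \<and> y = a) \<and> lz = a \<and> z = a" (is "?L \<longleftrightarrow> ?R")
proof
  assume ?L
  then show ?R using assms by (auto simp: preds_def)
next
  assume ?R
  moreover from this have "(Suc a, 0) \<in> preds a b" by (simp add: preds_def)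
  ultimately show ?L using assms by (intro conjI bexI[of _ "(Suc a, 0)"]) auto
qed

text \<open>A common peak is a common rise from \<open>(a, 0)\<close> followed by a common fall back to \<open>(a, 0)\<close>,
  so the extensions to be removed are as many as the pairs two steps earlier in that state.\<close>

lemma card_peaks:
  "card {q. truncate (Suc m) q \<in> (\<Union>(a', b')\<in>preds a b. pairs_at (Suc m) a' b') \<and>
       snd q (Suc (Suc m)) = a \<and> fst q (Suc (Suc m)) = a + 2 * b \<and> common_peak q m} =
    (if b = 0 \<and> 1 \<le> a then card (pairs_at m a 0) else 0)"
  (is "card ?S = _")
proof -
  let ?R = "{(u, l) \<in> path_pairs (Suc m). common_rise (u, l) m \<and> u m = a}"
  have "(u, l) \<in> ?S \<longleftrightarrow> b = 0 \<and> 1 \<le> a \<and> truncate (Suc m) (u, l) \<in> ?R \<and>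
      snd (u, l) (Suc (Suc m)) = a \<and> fst (u, l) (Suc (Suc m)) = a" for u l
  proof (cases "truncate (Suc m) (u, l) \<in> path_pairs (Suc m)")
    case True
    then have step: "u (Suc m) = Suc (u m) \<or> u m = Suc (u (Suc m))"
      by (simp add: path_pairs_def truncate_def ballot_def)
    have S: "truncate (Suc m) (u, l) \<in> pairs_at (Suc m) a' b' \<longleftrightarrow> l (Suc m) = a' \<and> u (Suc m) = a' + 2 * b'"
        for a' b'
      using True by (simp add: pairs_at_def truncate_def)
    have "(u, l) \<in> ?S \<longleftrightarrow> (\<exists>(a', b')\<in>preds a b. l (Suc m) = a' \<and> u (Suc m) = a' + 2 * b') \<and>
       l (Suc (Suc m)) = a \<and> u (Suc (Suc m)) = a + 2 * b \<and>
       l (Suc m) = u (Suc m) \<and> u m < u (Suc m) \<and> 1 \<le> u m \<and> u (Suc (Suc m)) < u (Suc m)"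
      by (simp add: S common_peak_def common_rise_def case_prod_beta)
    also have "\<dots> \<longleftrightarrow> b = 0 \<and> 1 \<le> a \<and> (l (Suc m) = u (Suc m) \<and> u m < u (Suc m) \<and> 1 \<le> u m \<and> u m = a) \<and>
       l (Suc (Suc m)) = a \<and> u (Suc (Suc m)) = a"
      using step by (rule peak_arith)
    finally show ?thesis
      using True by (simp add: truncate_def common_rise_def)
  next
    case False
    then show ?thesis by (auto simp: pairs_at_def)
  qed
  then have *: "q \<in> ?S \<longleftrightarrow> b = 0 \<and> 1 \<le> a \<and>
      truncate (Suc m) q \<in> ?R \<and> snd q (Suc (Suc m)) = a \<and> fst q (Suc (Suc m)) = a" for q
    by (metis (no_types, lifting) surj_pair)
  have S: "?S = (if b = 0 \<and> 1 \<le> a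
      then {q. truncate (Suc m) q \<in> ?R \<and> snd q (Suc (Suc m)) = a \<and> fst q (Suc (Suc m)) = a} else {})"
    by (rule set_eqI, subst *) (cases "b = 0 \<and> 1 \<le> a", simp, auto)
  have R: "card ?R = card (pairs_at m a 0)" if "1 \<le> a"
    using that by (rule card_rises)
  have E: "card {q. truncate (Suc m) q \<in> ?R \<and> snd q (Suc (Suc m)) = a \<and> fst q (Suc (Suc m)) = a} = card ?R"
    by (rule card_extensions) blast
  show ?thesis
  proof (cases "b = 0 \<and> 1 \<le> a")
    case True
    then show ?thesis unfolding S if_P[OF True] E by (intro R) simp
  next
    case False
    show ?thesis unfolding S if_not_P[OF False] by (rule card.empty)
  qed
qed


lemma pairs_at_disjoint: "(a, b) \<noteq> (a', b') \<Longrightarrow> pairs_at n a b \<inter> pairs_at n a' b' = {}"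
  by (auto simp: pairs_at_def)

lemma finite_preds: "finite (preds a b)"
  by (rule finite_subset[of _ "{..Suc a} \<times> {..Suc b}"]) (auto simp: preds_def)

text \<open>This is the recursion that the functional equation encodes; the second summand on the left
  is the term with \<open>z\<^sup>2\<close>.\<close>

lemma card_pairs_at_Suc:
  "card (pairs_at (Suc n) a b) + (if n = 0 \<or> a = 0 \<or> b \<noteq> 0 then 0 else card (pairs_at (n - 1) a 0)) =
     (\<Sum>(a', b')\<in>preds a b. card (pairs_at n a' b'))"
proof -
  let ?X = "\<Union>(a', b')\<in>preds a b. pairs_at n a' b'"
  let ?E = "{q. truncate n q \<in> ?X \<and> snd q (Suc n) = a \<and> fst q (Suc n) = a + 2 * b}"
  let ?B = "{q. \<exists>m. n = Suc m \<and> common_peak q m}"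
  have X: "?X \<subseteq> path_pairs n" by (auto simp: pairs_at_def)
  have cardX: "card ?X = (\<Sum>(a', b')\<in>preds a b. card (pairs_at n a' b'))"
    using pairs_at_disjoint finite_preds finite_pairs_at
    by (subst card_UN_disjoint) (auto simp: case_prod_beta; blast)+
  have "finite ?X" by (rule finite_subset[OF X finite_path_pairs])
  then have "finite ?E"
    by (rule bij_betw_finite[OF bij_betw_extensions[OF X], THEN iffD1])
  then have split: "card ?E = card (?E \<inter> ?B) + card (?E - ?B)"
    by (rule card_Int_Diff)
  have overlap: "card (?E \<inter> ?B) = (if n = 0 \<or> a = 0 \<or> b \<noteq> 0 then 0 else card (pairs_at (n - 1) a 0))"
  proof (cases n)
    case (Suc m)
    have "?E \<inter> ?B = {q. truncate (Suc m) q \<in> (\<Union>(a', b')\<in>preds a b. pairs_at (Suc m) a' b') \<and>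
       snd q (Suc (Suc m)) = a \<and> fst q (Suc (Suc m)) = a + 2 * b \<and> common_peak q m}"
      using Suc by auto
    then show ?thesis using card_peaks[of m a b] Suc by simp
  qed simp
  show ?thesis
    using split unfolding overlap card_extensions[OF X] cardX pairs_at_Suc by (simp only: add.commute)
qed


lemma sum_preds:
  "(\<Sum>(a', b')\<in>preds a b. (g a' b' :: nat)) = g (Suc a) b + (if b = 0 then 0 else g (Suc a) (b - 1))
     + (if a = 0 then 0 else g (a - 1) b + g (a - 1) (Suc b))"
proof -
  have "preds a b = {(Suc a, b)} \<union> (if b = 0 then {} else {(Suc a, b - 1)}) \<union>
      (if a = 0 then {} else {(a - 1, b), (a - 1, Suc b)})"
    by (auto simp: preds_def)
  then show ?thesis by (cases "a = 0"; cases "b = 0"; simp)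
qed

lemma pairs_at_empty: "n < a \<or> n < b \<Longrightarrow> pairs_at n a b = {}"
proof (rule ccontr)
  assume *: "n < a \<or> n < b" "pairs_at n a b \<noteq> {}"
  then obtain u l where "(u, l) \<in> pairs_at n a b" by fastforce
  then show False
    using *(1) ballot_le[of n u n] ballot_le[of n l n] by (auto simp: pairs_at_def path_pairs_def)
qed

lemma card_path_pairs: "card (path_pairs n) = (\<Sum>a\<le>n. \<Sum>b\<le>n. card (pairs_at n a b))"
proof -
  have "q \<in> (\<Union>(a, b)\<in>{..n} \<times> {..n}. pairs_at n a b)" if q: "q \<in> path_pairs n" for q
  proof -
    obtain u l where ul: "q = (u, l)" by fastforce
    obtain b where "u n = l n + 2 * b"
      using q even_gap[of n u l] by (auto simp: ul path_pairs_def)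
    then have *: "q \<in> pairs_at n (l n) b" using q by (simp add: pairs_at_def ul)
    then have "l n \<le> n" "b \<le> n" using pairs_at_empty[of n "l n" b] by (auto simp: not_less[symmetric])
    with * show ?thesis by auto
  qed
  then have "path_pairs n = (\<Union>(a, b)\<in>{..n} \<times> {..n}. pairs_at n a b)"
    by (auto simp: pairs_at_def)
  also have "card \<dots> = (\<Sum>(a, b)\<in>{..n} \<times> {..n}. card (pairs_at n a b))"
  proof (subst card_UN_disjoint)
    show "\<forall>i\<in>{..n} \<times> {..n}. \<forall>j\<in>{..n} \<times> {..n}. i \<noteq> j \<longrightarrow>
        (case i of (a, b) \<Rightarrow> pairs_at n a b) \<inter> (case j of (a, b) \<Rightarrow> pairs_at n a b) = {}"
      using pairs_at_disjoint by fastforce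
  qed (auto simp: finite_pairs_at case_prod_beta)
  also have "\<dots> = (\<Sum>a\<le>n. \<Sum>b\<le>n. card (pairs_at n a b))"
    by (simp add: sum.cartesian_product)
  finally show ?thesis .
qed

text \<open>Here a final common rise is excluded too: after reflection at the axis it would be a
  common peak.\<close>

definition good_pairs :: "nat \<Rightarrow> ((nat \<Rightarrow> nat) \<times> (nat \<Rightarrow> nat)) set" where
  "good_pairs n = {q \<in> path_pairs n. \<forall>m. n = Suc m \<longrightarrow> \<not> common_rise q m}"

lemma card_good_pairs_0: "card (good_pairs 0) = card (path_pairs 0)"
  by (simp add: good_pairs_def)

text \<open>A final common rise starts at some height \<open>a \<ge> 1\<close> where both paths meet; this accounts for
  the correction \<open>- z F(1,0) + z F(0,0)\<close>.\<close>

lemma card_good_pairs_Suc: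
  "card (good_pairs (Suc m)) + (\<Sum>a=1..m. card (pairs_at m a 0)) = card (path_pairs (Suc m))"
proof -
  let ?R = "\<lambda>a. {(u, l) \<in> path_pairs (Suc m). common_rise (u, l) m \<and> u m = a}"
  let ?B = "{q \<in> path_pairs (Suc m). common_rise q m}"
  have fin: "finite (?R a)" for a
    by (rule finite_subset[OF _ finite_path_pairs[of "Suc m"]]) auto
  have "?B = (\<Union>a\<in>{1..m}. ?R a)"
  proof (intro set_eqI)
    fix q :: "(nat \<Rightarrow> nat) \<times> (nat \<Rightarrow> nat)"
    obtain u l where ul: "q = (u, l)" by fastforce
    have "1 \<le> u m \<and> u m \<le> m" if "q \<in> ?B"
      using that ballot_le[of "Suc m" u m] by (auto simp: ul path_pairs_def common_rise_def)
    then show "q \<in> ?B \<longleftrightarrow> q \<in> (\<Union>a\<in>{1..m}. ?R a)"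
      by (auto simp: ul)
  qed
  also have "card \<dots> = (\<Sum>a=1..m. card (?R a))"
    by (subst card_UN_disjoint) (auto simp: fin[simplified])
  also have "\<dots> = (\<Sum>a=1..m. card (pairs_at m a 0))"
    by (rule sum.cong) (auto simp: card_rises)
  finally have "card ?B = (\<Sum>a=1..m. card (pairs_at m a 0))" .
  moreover have "card (good_pairs (Suc m)) + card ?B = card (good_pairs (Suc m) \<union> ?B)"
    by (rule card_Un_disjoint[symmetric])
        (auto simp: good_pairs_def intro: finite_subset[OF _ finite_path_pairs])
  moreover have "good_pairs (Suc m) \<union> ?B = path_pairs (Suc m)"
    by (auto simp: good_pairs_def)
  ultimately show ?thesis by simp
qed

section \<open>Down-sets of the left half as lattice paths\<close>

text \<open>The intervals on or below the path, when \<open>[i, j]\<close> is drawn in column \<open>i + j\<close> at height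
  \<open>j - i + 2\<close>; the inequality is arranged to avoid subtraction on the natural numbers.\<close>

definition ideal :: "nat \<Rightarrow> (nat \<Rightarrow> nat) \<Rightarrow> int set set" where
  "ideal n p = {{int i..int j} |i j. 1 \<le> i \<and> i \<le> j \<and> i + j \<le> n \<and> j + 2 \<le> p (i + j) + i}"

lemma interval_in_ideal:
  "i \<le> j \<Longrightarrow> {int i..int j} \<in> ideal n p \<longleftrightarrow> 1 \<le> i \<and> i + j \<le> n \<and> j + 2 \<le> p (i + j) + i"
  by (auto simp: ideal_def Icc_eq_Icc)

lemma ballot_lipschitz: "ballot n p \<Longrightarrow> s + d \<le> n \<Longrightarrow> p (s + d) \<le> p s + d \<and> p s \<le> p (s + d) + d"
proof (induction d)
  case (Suc d)
  then have "p (Suc (s + d)) = Suc (p (s + d)) \<or> p (s + d) = Suc (p (Suc (s + d)))"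
    by (simp add: ballot_def)
  with Suc show ?case by auto
qed simp

text \<open>Removing \<open>d\<close> points from the ends of an interval lowers its height by \<open>d\<close> and moves it by
  at most \<open>d\<close> columns, and a path changes by at most 1 per column.\<close>

lemma ideal_in_down_sets:
  assumes "ballot n p"
  shows "ideal n p \<in> down_sets (half_poset n)"
proof -
  have "y \<in> ideal n p" if x: "x \<in> ideal n p" and y: "y \<in> half_poset n" and "y < x" for x y
  proof -
    obtain i j where ij: "x = {int i..int j}" "1 \<le> i" "i \<le> j" "i + j \<le> n" "j + 2 \<le> p (i + j) + i"
      using x by (auto simp: ideal_def)
    obtain i' j' where ij': "y = {int i'..int j'}" "1 \<le> i'" "i' \<le> j'" "i' + j' \<le> n"
      using y by (auto simp: half_poset_def)
    have "i \<le> i'" "j' \<le> j" using \<open>y < x\<close> ij ij' by (auto simp: psubset_eq)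
    moreover have "j' + 2 \<le> p (i' + j') + i'"
    proof (cases "i + j \<le> i' + j'")
      case True
      then show ?thesis
        using ballot_lipschitz[OF assms, of "i + j" "i' + j' - (i + j)"] ij ij' calculation by auto
    next
      case False
      then show ?thesis
        using ballot_lipschitz[OF assms, of "i' + j'" "i + j - (i' + j')"] ij ij' calculation by auto
    qed
    ultimately show ?thesis using ij' by (simp add: interval_in_ideal)
  qed
  moreover have "ideal n p \<subseteq> half_poset n" by (auto simp: ideal_def half_poset_def)
  ultimately show ?thesis unfolding down_sets_def by blast
qed

text \<open>Two paths have the same parity in each column, so if \<open>p\<close> is above \<open>q\<close> somewhere, then it
  is so by at least 2, and the point of \<open>p\<close> in that column is an actual interval that lies
  above \<open>q\<close>.\<close>

lemma ideal_subset_iff: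
  assumes p: "ballot n p" and q: "ballot n q"
  shows "ideal n p \<subseteq> ideal n q \<longleftrightarrow> p \<le> q"
proof
  assume sub: "ideal n p \<subseteq> ideal n q"
  show "p \<le> q"
  proof (rule le_funI, rule ccontr)
    fix s assume "\<not> p s \<le> q s"
    then have "q s < p s" by simp
    then have "s \<le> n" using p by (metis ballot_def not_le not_less_zero)
    have "even (p s + s)" "even (q s + s)" "p s \<le> s"
      using ballot_parity \<open>s \<le> n\<close> p q ballot_le by blast+
    with \<open>q s < p s\<close> have "q s + 2 \<le> p s" by presburger
    have "even (s - p s)" using \<open>even (p s + s)\<close> \<open>p s \<le> s\<close> by simp
    then obtain k where k: "s = p s + 2 * k" using \<open>p s \<le> s\<close> by (metis evenE le_add_diff_inverse)
    \<comment> \<open>The interval with \<open>i + j = s\<close> and \<open>j - i + 2 = p s\<close>, the point of the path in column \<open>s\<close>.\<close>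
    define i where "i = Suc k"
    define j where "j = k + p s - 1"
    have ij: "1 \<le> i" "i \<le> j" "i + j = s" "j + 2 = p s + i"
      using k \<open>q s + 2 \<le> p s\<close> by (auto simp: i_def j_def)
    then have "{int i..int j} \<in> ideal n p" using \<open>s \<le> n\<close> by (simp add: interval_in_ideal)
    then have "j + 2 \<le> q s + i" using sub ij by (metis interval_in_ideal subsetD)
    then show False using ij \<open>q s < p s\<close> by simp
  qed
next
  assume "p \<le> q"
  then show "ideal n p \<subseteq> ideal n q"
    by (fastforce simp: ideal_def le_fun_def intro: le_trans)
qed

text \<open>The path is \<open>s mod 2\<close> plus twice the number of intervals of \<open>U\<close> in column \<open>s\<close>. The
  intervals of a column form a chain, of which \<open>U\<close> contains the lowest ones. Removing one
  endpoint from an interval of \<open>U\<close> yields an interval of \<open>U\<close> in a neighbouring column, so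
  adjacent columns differ by one step.\<close>

lemma down_set_is_ideal:
  assumes U: "U \<in> down_sets (half_poset n)"
  shows "\<exists>p. ballot n p \<and> ideal n p = U"
proof -
  \<comment> \<open>The left endpoints of the intervals of \<open>U\<close> in column \<open>s\<close>.\<close>
  define C where "C s = {i. 1 \<le> i \<and> 2 * i \<le> s \<and> {int i..int (s - i)} \<in> U}" for s
  define p where "p s = (if s \<le> n then s mod 2 + 2 * card (C s) else 0)" for s
  have down: "{int i'..int j'} \<in> U"
    if "{int i..int j} \<in> U" "i \<le> i'" "j' \<le> j" "i' \<le> j'" "1 \<le> i'" "i' + j' \<le> n" for i j i' j'
  proof (cases "i = i' \<and> j = j'")
    case False
    then have "{int i'..int j'} < {int i..int j}" using that by (auto simp: psubset_eq Icc_eq_Icc)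
    moreover have "{int i'..int j'} \<in> half_poset n" using that by (simp add: interval_in_half_poset)
    ultimately show ?thesis using U that unfolding down_sets_def by blast
  qed (use that in simp)
  have fin: "finite (C s)" for s
    by (rule finite_subset[of _ "{..s}"]) (auto simp: C_def)
  \<comment> \<open>In column \<open>s\<close> a larger left endpoint means a smaller interval, so \<open>C s\<close> is an upper
    segment of \<open>{1..s div 2}\<close> and its cardinality decides membership.\<close>
  have mem: "i \<in> C s \<longleftrightarrow> s div 2 + 1 \<le> i + card (C s)" if "1 \<le> i" "2 * i \<le> s" "s \<le> n" for i s
  proof
    assume i: "i \<in> C s"
    have "{i..s div 2} \<subseteq> C s"
    proof
      fix i' assume "i' \<in> {i..s div 2}"
      then show "i' \<in> C s" using i that down[of i "s - i" i' "s - i'"] by (auto simp: C_def)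
    qed
    then have "card {i..s div 2} \<le> card (C s)" by (rule card_mono[OF fin])
    then show "s div 2 + 1 \<le> i + card (C s)" by simp
  next
    assume *: "s div 2 + 1 \<le> i + card (C s)"
    show "i \<in> C s"
    proof (rule ccontr)
      assume i: "i \<notin> C s"
      have "C s \<subseteq> {i<..s div 2}"
      proof
        fix i' assume i': "i' \<in> C s"
        show "i' \<in> {i<..s div 2}"
        proof (rule ccontr)
          assume "i' \<notin> {i<..s div 2}"
          then have "i' \<le> i" using i' by (auto simp: C_def)
          moreover from this have "s - i \<le> s - i'" "i \<le> s - i" "i + (s - i) \<le> n" using that by auto
          ultimately show False using i i' that down[of i' "s - i'" i "s - i"] by (simp add: C_def)
        qed
      qed
      then have "card (C s) \<le> card {i<..s div 2}" by (rule card_mono[rotated]) simp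
      then show False using * that by simp
    qed
  qed
  \<comment> \<open>Removing the right endpoint leads from column \<open>s + 1\<close> to column \<open>s\<close> and keeps the left endpoint; only
    a one-point interval has no image, and it occurs in even columns only.\<close>
  have up: "card (C (Suc s)) \<le> card (C s) + s mod 2" if "s < n" for s
  proof -
    have "C (Suc s) \<subseteq> C s \<union> {i. 2 * i = Suc s}"
    proof
      fix i assume i: "i \<in> C (Suc s)"
      show "i \<in> C s \<union> {i. 2 * i = Suc s}"
        using i that down[of i "Suc s - i" i "s - i"] by (auto simp: C_def)
    qed
    moreover have "{i. 2 * i = Suc s} = (if even s then {} else {Suc s div 2})"
      by (auto simp: even_Suc_div_two) presburger+
    ultimately have "card (C (Suc s)) \<le> card (C s \<union> (if even s then {} else {Suc s div 2}))"
      by (intro card_mono) (auto simp: fin)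
    also have "\<dots> \<le> card (C s) + s mod 2"
      by (rule order_trans[OF card_Un_le]) (auto simp: odd_iff_mod_2_eq_one)
    finally show ?thesis .
  qed
  \<comment> \<open>Removing the left endpoint leads from column \<open>s\<close> to column \<open>s + 1\<close>.\<close>
  have down_step: "card (C s) + s mod 2 \<le> card (C (Suc s)) + 1" if "s < n" for s
  proof -
    have "Suc ` (C s - (if even s then {s div 2} else {})) \<subseteq> C (Suc s)"
    proof
      fix i' assume "i' \<in> Suc ` (C s - (if even s then {s div 2} else {}))"
      then obtain i where i: "i' = Suc i" "i \<in> C s" "i \<notin> (if even s then {s div 2} else {})" by blast
      then have "2 * i \<noteq> s" by (cases "even s") auto
      with i have "2 * Suc i \<le> Suc s" by (auto simp: C_def)
      then show "i' \<in> C (Suc s)" using i that down[of i "s - i" "Suc i" "s - i"] by (auto simp: C_def)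
    qed
    then have "card (Suc ` (C s - (if even s then {s div 2} else {}))) \<le> card (C (Suc s))"
      by (rule card_mono[OF fin])
    then have "card (C s - (if even s then {s div 2} else {})) \<le> card (C (Suc s))"
      by (simp add: card_image)
    moreover have "card (C s) - card (if even s then {s div 2} else {})
        \<le> card (C s - (if even s then {s div 2} else {}))"
      by (rule diff_card_le_card_Diff) simp
    ultimately show ?thesis by (auto simp: odd_iff_mod_2_eq_one split: if_splits)
  qed
  have "ballot n p"
    unfolding ballot_def
  proof (intro conjI allI impI)
    have "C 0 = {}" by (auto simp: C_def)
    then show "p 0 = 0" by (simp add: p_def)
    fix s assume s: "s < n"
    show "p (Suc s) = Suc (p s) \<or> p s = Suc (p (Suc s))"
      using up[OF s] down_step[OF s] s
          by (cases "even s") (auto simp: p_def even_iff_mod_2_eq_zero odd_iff_mod_2_eq_one mod_Suc)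
  qed (simp add: p_def)
  moreover have "ideal n p = U"
  proof -
    have "{int i..int j} \<in> ideal n p \<longleftrightarrow> {int i..int j} \<in> U" if "1 \<le> i" "i \<le> j" "i + j \<le> n" for i j
    proof -
      have "{int i..int j} \<in> U \<longleftrightarrow> i \<in> C (i + j)" using that by (simp add: C_def)
      also have "\<dots> \<longleftrightarrow> (i + j) div 2 + 1 \<le> i + card (C (i + j))" using that by (intro mem) auto
      also have "\<dots> \<longleftrightarrow> j + 2 \<le> p (i + j) + i"
      proof -
        have "(i + j) mod 2 + 2 * ((i + j) div 2) = i + j" by simp
        then show ?thesis using that by (simp only: p_def if_True) presburger
      qed
      finally show ?thesis using that by (simp add: interval_in_ideal)
    qed
    then have "S \<in> ideal n p \<longleftrightarrow> S \<in> U" if "S \<in> half_poset n" for S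
      using that by (auto simp: half_poset_def)
    moreover have "U \<subseteq> half_poset n" using U by (simp add: down_sets_def)
    moreover have "ideal n p \<subseteq> half_poset n" by (auto simp: ideal_def half_poset_def)
    ultimately show ?thesis by blast
  qed
  ultimately show ?thesis by blast
qed

section \<open>Maximal elements as common peaks\<close>

text \<open>The end point of a common rise is an interval \<open>[i, j]\<close> on both paths. If some element of
  the upper ideal lies strictly above it, then so does one of \<open>[i - 1, j]\<close> and \<open>[i, j + 1]\<close>,
  in the previous and in the next column. The former is too high for the rising path, so the
  latter belongs to the ideal and the upper path keeps rising.\<close>

lemma common_rise_below_maximal:
  assumes u: "ballot n u" and rise: "common_rise (u, l) s" and "s < n"
    and covered: "\<forall>x\<in>ideal n l. \<exists>y\<in>ideal n u. x < y"
  shows "Suc s < n \<and> u (Suc s) < u (Suc (Suc s))"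
proof -
  define h where "h = u (Suc s)"
  have h: "l (Suc s) = h" "u s + 1 = h" "2 \<le> h"
    using rise u \<open>s < n\<close> by (auto simp: common_rise_def ballot_def h_def)
  have "h \<le> Suc s" "even (h + Suc s)"
    using u \<open>s < n\<close> ballot_le ballot_parity[of n u "Suc s"] by (auto simp: h_def)
  then have "even (Suc s - h)" by auto
  then obtain k where k: "Suc s = h + 2 * k" using \<open>h \<le> Suc s\<close> by (metis evenE le_add_diff_inverse)
  \<comment> \<open>The interval in column \<open>s + 1\<close> at height \<open>h\<close>.\<close>
  define i where "i = Suc k"
  define j where "j = k + h - 1"
  have ij: "1 \<le> i" "i \<le> j" "i + j = Suc s" "j + 2 = h + i"
    using k h by (auto simp: i_def j_def)
  then have "{int i..int j} \<in> ideal n l" using \<open>s < n\<close> h by (simp add: interval_in_ideal)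
  then obtain y where y: "y \<in> ideal n u" "{int i..int j} < y" using covered by blast
  obtain i' j' where ij': "y = {int i'..int j'}" "1 \<le> i'" "i' \<le> j'" "i' + j' \<le> n" "j' + 2 \<le> u (i' + j') + i'"
    using y by (auto simp: ideal_def)
  have le: "i' \<le> i" "j \<le> j'" "i' \<noteq> i \<or> j' \<noteq> j"
    using y ij ij' by (auto simp: psubset_eq)
  have in_u: "{int a..int b} \<in> ideal n u" if "i' \<le> a" "a \<le> b" "b \<le> j'" "a + b \<le> n" for a b
  proof (cases "a = i' \<and> b = j'")
    case False
    have "{int a..int b} \<in> half_poset n" using that ij' by (simp add: interval_in_half_poset)
    moreover have "{int a..int b} < y" using that False ij' by (auto simp: psubset_eq Icc_eq_Icc)
    ultimately show ?thesis using y(1) ideal_in_down_sets[OF u] unfolding down_sets_def by blast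
  qed (use y ij' in simp)
  have "i' = i"
  proof (rule ccontr)
    assume "i' \<noteq> i"
    then have i: "i' \<le> i - 1" "2 \<le> i" using le ij' by auto
    then have "{int (i - 1)..int j} \<in> ideal n u" using ij le ij' \<open>s < n\<close> by (intro in_u) auto
    then have "j + 2 \<le> u (i - 1 + j) + (i - 1)" using i ij by (simp add: interval_in_ideal del: of_nat_diff)
    moreover have "i - 1 + j = s" using i ij by simp
    ultimately show False using ij h by simp
  qed
  with le have "Suc j \<le> j'" by simp
  then have "Suc s < n" using ij ij' \<open>i' = i\<close> by simp
  have "{int i..int (Suc j)} \<in> ideal n u"
    using \<open>Suc j \<le> j'\<close> \<open>Suc s < n\<close> ij \<open>i' = i\<close> by (intro in_u) auto
  then have "Suc j + 2 \<le> u (i + Suc j) + i" using ij by (subst (asm) interval_in_ideal) auto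
  then show ?thesis using ij \<open>Suc s < n\<close> by (simp add: h_def)
qed

text \<open>Strictly below the upper path, an interval can be enlarged at both ends. On the upper path
  it can be enlarged to the left if the path falls into its column; otherwise both paths
  rise into it, and they do not turn there, so it can be enlarged to the right.\<close>

lemma covered_if_no_common_peak:
  assumes u: "ballot n u" and l: "ballot n l" and "l \<le> u"
    and rises: "\<And>s. s < n \<Longrightarrow> common_rise (u, l) s \<Longrightarrow> Suc s < n \<and> u (Suc s) < u (Suc (Suc s))"
    and x: "x \<in> ideal n l"
  shows "\<exists>y\<in>ideal n u. x < y"
proof -
  obtain i j where ij: "x = {int i..int j}" "1 \<le> i" "i \<le> j" "i + j \<le> n" "j + 2 \<le> l (i + j) + i"
    using x by (auto simp: ideal_def)
  have extend: ?thesis if "{int a..int b} \<in> ideal n u" "a \<le> i" "j \<le> b" "a < i \<or> j < b" for a b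
    using that ij by (intro bexI[of _ "{int a..int b}"]) (auto simp: psubset_eq Icc_eq_Icc)
  define s where "s = i + j - 1"
  have s: "i + j = Suc s" "s < n" using ij by (auto simp: s_def)
  have "l (Suc s) \<le> u (Suc s)" using \<open>l \<le> u\<close> by (simp add: le_fun_def)
  have bounds: "u (Suc s) \<le> Suc s" "u s \<le> s" "even (u (Suc s) + Suc s)"
    using ballot_le[OF u] ballot_parity[OF u] s by (auto simp: Suc_le_eq)
  have step: "u (Suc s) = Suc (u s) \<or> u s = Suc (u (Suc s))" using u s by (simp add: ballot_def)
  consider "j + 2 < u (Suc s) + i" | "j + 2 = u (Suc s) + i" "u s = Suc (u (Suc s))"
    | "j + 2 = u (Suc s) + i" "u (Suc s) = Suc (u s)"
    using ij s \<open>l (Suc s) \<le> u (Suc s)\<close> step by fastforce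
  then show ?thesis
  proof cases
    case 1
    \<comment> \<open>Heights and paths have the same parity in each column, so the gap is at least 2.\<close>
    have "j + 4 \<le> u (Suc s) + i"
      using 1 bounds(3) s by presburger
    moreover from this have "2 \<le> i" using bounds s by linarith
    moreover have "i - 1 + Suc j = Suc s" using s ij by simp
    ultimately have "{int (i - 1)..int (Suc j)} \<in> ideal n u"
      using ij s by (subst interval_in_ideal) auto
    then show ?thesis by (rule extend) (use ij in auto)
  next
    case 2
    then have "2 \<le> i" using bounds s by linarith
    moreover have "i - 1 + j = s" using s ij by simp
    ultimately have "{int (i - 1)..int j} \<in> ideal n u"
      using ij s 2 by (subst interval_in_ideal) auto
    then show ?thesis by (rule extend) (use ij in auto)
  next
    case 3
    have "l (Suc s) = u (Suc s)" using 3 ij s \<open>l (Suc s) \<le> u (Suc s)\<close> by simp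
    then have "common_rise (u, l) s" using 3 ij by (simp add: common_rise_def)
    then have *: "Suc s < n" "u (Suc s) < u (Suc (Suc s))" using rises s by auto
    have sum: "i + Suc j = Suc (Suc s)" using s by simp
    have "Suc j + 2 \<le> u (i + Suc j) + i" unfolding sum using * 3 by simp
    moreover have "1 \<le> i" "i \<le> Suc j" "i + Suc j \<le> n" using ij * sum by auto
    ultimately have "{int i..int (Suc j)} \<in> ideal n u"
      using interval_in_ideal by blast
    then show ?thesis by (rule extend) (use ij in auto)
  qed
qed

lemma good_pairs_iff:
  "(u, l) \<in> good_pairs n \<longleftrightarrow> ballot n u \<and> ballot n l \<and> l \<le> u \<and>
     (\<forall>s<n. common_rise (u, l) s \<longrightarrow> Suc s < n \<and> u (Suc s) < u (Suc (Suc s)))"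
proof -
  have "(Suc s < n \<longrightarrow> \<not> common_peak (u, l) s) \<and> (n = Suc s \<longrightarrow> \<not> common_rise (u, l) s) \<longleftrightarrow>
      (s < n \<longrightarrow> common_rise (u, l) s \<longrightarrow> Suc s < n \<and> u (Suc s) < u (Suc (Suc s)))"
    if "ballot n u" for s
  proof (cases "Suc s < n")
    case True
    then have "u (Suc (Suc s)) = Suc (u (Suc s)) \<or> u (Suc s) = Suc (u (Suc (Suc s)))"
      using that by (simp add: ballot_def)
    then show ?thesis using True by (auto simp: common_peak_def)
  qed auto
  then show ?thesis unfolding good_pairs_def path_pairs_def by (simp, blast)
qed

text \<open>Paths encode down-sets, nesting of paths is inclusion, and common peaks are the maximal
  elements of the larger down-set that lie in the smaller one.\<close>

lemma bij_betw_good_pairs: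
  "bij_betw (\<lambda>(u, l). (ideal n u, ideal n l)) (good_pairs n) (reduced_pairs (half_poset n))"
proof -
  have inj: "u = u'" if "ballot n u" "ballot n u'" "ideal n u = ideal n u'" for u u'
    using that ideal_subset_iff[of n u u'] ideal_subset_iff[of n u' u] by auto
  have reduced: "(ideal n u, ideal n l) \<in> reduced_pairs (half_poset n) \<longleftrightarrow> (u, l) \<in> good_pairs n"
    if ul: "ballot n u" "ballot n l" for u l
  proof
    assume "(ideal n u, ideal n l) \<in> reduced_pairs (half_poset n)"
    then have "l \<le> u" "\<forall>x\<in>ideal n l. \<exists>y\<in>ideal n u. x < y"
      using ideal_subset_iff[of n l u] ul unfolding reduced_pairs_def by auto
    then show "(u, l) \<in> good_pairs n"
      unfolding good_pairs_iff using ul common_rise_below_maximal[OF ul(1)] by blast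
  next
    assume "(u, l) \<in> good_pairs n"
    then have "l \<le> u" "\<And>s. s < n \<Longrightarrow> common_rise (u, l) s \<Longrightarrow> Suc s < n \<and> u (Suc s) < u (Suc (Suc s))"
      by (simp_all add: good_pairs_iff)
    then have "\<forall>x\<in>ideal n l. \<exists>y\<in>ideal n u. x < y"
      using covered_if_no_common_peak[OF ul] by blast
    then show "(ideal n u, ideal n l) \<in> reduced_pairs (half_poset n)"
      using ul \<open>l \<le> u\<close> by (simp add: reduced_pairs_def ideal_in_down_sets ideal_subset_iff)
  qed
  show ?thesis
    unfolding bij_betw_def
  proof
    show "inj_on (\<lambda>(u, l). (ideal n u, ideal n l)) (good_pairs n)"
      using inj by (auto simp: inj_on_def good_pairs_iff)
    show "(\<lambda>(u, l). (ideal n u, ideal n l)) ` good_pairs n = reduced_pairs (half_poset n)"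
    proof
      show "(\<lambda>(u, l). (ideal n u, ideal n l)) ` good_pairs n \<subseteq> reduced_pairs (half_poset n)"
        using reduced by (auto simp: good_pairs_iff)
      show "reduced_pairs (half_poset n) \<subseteq> (\<lambda>(u, l). (ideal n u, ideal n l)) ` good_pairs n"
      proof
        fix q assume q: "q \<in> reduced_pairs (half_poset n)"
        then obtain U L where UL: "q = (U, L)" "U \<in> down_sets (half_poset n)" "L \<in> down_sets (half_poset n)"
          by (auto simp: reduced_pairs_def)
        then obtain u l where "ballot n u" "ideal n u = U" "ballot n l" "ideal n l = L"
          using down_set_is_ideal by meson
        then show "q \<in> (\<lambda>(u, l). (ideal n u, ideal n l)) ` good_pairs n"
          using reduced[of u l] q UL by force
      qed
    qed
  qed
qed

lemma finite_half_poset: "finite (half_poset n)"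
  by (rule finite_subset[of _ "(\<lambda>(i, j). {int i..int j}) ` ({..n} \<times> {..n})"]) (auto simp: half_poset_def)

lemma card_sym_interval_closed_sets: "card (sym_interval_closed_sets (int n - 1)) = card (good_pairs n)"
  using bij_betw_same_card[OF bij_betw_left_half[of n]]
    bij_betw_same_card[OF bij_betw_reduced_pairs[OF finite_half_poset[of n]]]
    bij_betw_same_card[OF bij_betw_good_pairs[of n]] by simp

section \<open>The generating function\<close>

lemma card_pairs_at_0: "card (pairs_at 0 a b) = (if a = 0 \<and> b = 0 then 1 else 0)"
proof -
  have "ballot 0 p \<longleftrightarrow> p = (\<lambda>s. 0)" for p
    by (auto simp: ballot_def) (metis gr0I)
  then have "pairs_at 0 a b = (if a = 0 \<and> b = 0 then {(\<lambda>s. 0, \<lambda>s. 0)} else {})"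
    by (auto simp: pairs_at_def path_pairs_def)
  then show ?thesis by simp
qed

lemma int_card_pairs_at_Suc:
  "int (card (pairs_at (Suc n) a b)) = step_count (\<lambda>a b. int (card (pairs_at n a b))) a b
     - (if n = 0 \<or> a = 0 \<or> b \<noteq> 0 then 0 else int (card (pairs_at (n - 1) a 0)))"
proof -
  have "int (card (pairs_at (Suc n) a b)) + int (if n = 0 \<or> a = 0 \<or> b \<noteq> 0 then 0
      else card (pairs_at (n - 1) a 0))
    = step_count (\<lambda>a b. int (card (pairs_at n a b))) a b"
    unfolding of_nat_add[symmetric] card_pairs_at_Suc sum_preds step_count_def by simp
  then show ?thesis by (cases "n = 0 \<or> a = 0 \<or> b \<noteq> 0") auto
qed

lemma coef_functional_equation:
  assumes "functional_equation F"
  shows "coef F n a b = int (card (pairs_at n a b))"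
proof (induction n arbitrary: a b rule: less_induct)
  case (less n)
  show ?case
  proof (cases n)
    case 0
    then show ?thesis using assms by (simp add: functional_equation_coef card_pairs_at_0)
  next
    case (Suc m)
    have "step_count (coef F m) a b = step_count (\<lambda>a b. int (card (pairs_at m a b))) a b"
      using less Suc by (simp add: step_count_def)
    moreover have "coef F (m - 1) a 0 = int (card (pairs_at (m - 1) a 0))" if "m \<noteq> 0"
      using less Suc that by simp
    ultimately show ?thesis
      using assms Suc int_card_pairs_at_Suc[of m a b] by (simp add: functional_equation_coef)
  qed
qed

theorem theorem4p4:
  shows "(\<exists>F. functional_equation F) \<and>
    (\<forall>F. functional_equation F \<longrightarrow>
      Abs_fps (\<lambda>n. int (card (sym_interval_closed_sets (int n - 1)))) =
        series_at F 1 1 - fps_X * series_at F 1 0 + fps_X * series_at F 0 0)"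
proof (intro conjI allI impI)
  obtain F where F: "coef F = (\<lambda>n a b. int (card (pairs_at n a b)))"
    using series_with_coef[of "\<lambda>n a b. int (card (pairs_at n a b))"] pairs_at_empty by auto
  then have "functional_equation F"
    unfolding functional_equation_coef F using card_pairs_at_0 int_card_pairs_at_Suc by simp
  then show "\<exists>F. functional_equation F" by blast
next
  fix F assume "functional_equation F"
  then have coef: "coef F = (\<lambda>n a b. int (card (pairs_at n a b)))"
    using coef_functional_equation by blast
  have vanish: "coef F n a b = 0" if "n < a \<or> n < b" for n a b
    using pairs_at_empty[OF that] by (simp add: coef)
  have total: "fps_nth (series_at F 1 1) n = int (card (path_pairs n))" for n
    by (simp add: series_at_corner[OF vanish] coef card_path_pairs)
  show "Abs_fps (\<lambda>n. int (card (sym_interval_closed_sets (int n - 1)))) =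
        series_at F 1 1 - fps_X * series_at F 1 0 + fps_X * series_at F 0 0"
  proof (rule fps_ext)
    fix n
    show "fps_nth (Abs_fps (\<lambda>n. int (card (sym_interval_closed_sets (int n - 1))))) n =
        fps_nth (series_at F 1 1 - fps_X * series_at F 1 0 + fps_X * series_at F 0 0) n"
    proof (cases n)
      case 0
      then show ?thesis
        using card_sym_interval_closed_sets[of 0] by (simp add: total card_good_pairs_0)
    next
      case (Suc m)
      have "{..m} = insert 0 {1..m}" by auto
      then have "fps_nth (series_at F 1 0) m - fps_nth (series_at F 0 0) m =
          (\<Sum>a=1..m. int (card (pairs_at m a 0)))"
        by (simp add: series_at_corner[OF vanish] coef)
      moreover have "int (card (good_pairs (Suc m))) =
          int (card (path_pairs (Suc m))) - (\<Sum>a=1..m. int (card (pairs_at m a 0)))"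
        by (simp add: card_good_pairs_Suc[symmetric])
      ultimately show ?thesis
        using card_sym_interval_closed_sets[of "Suc m"] by (simp add: total Suc)
    qed
  qed
qed

end
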